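(* Let $G$ be a countable discrete group with left regular representation $\lambda_G:G\to B(\ell^2(G))$. Then the system $\{\lambda_G(g)\}_{g\in G}$ has hereditary SAP; that is, for any subsets $S_1,S_2\subset G$, the compressed system $\{P_{S_1}\lambda_G(g)P_{S_2}\}_{g\in G}$ has the self-absorption property (SAP), where $P_{S_i}$ is the orthogonal projection of $\ell^2(G)$ onto $\ell^2(S_i)$.
   Context: SAP: a family $\{x_i\}_{i\in I}$ in a $C^*$-algebra $A$ has the self-absorption property (SAP) if for every $C^*$-algebra $B$ and every finitely supported family $(b_i)_{i\in I}$ in $B$, $$\Big\|\sum_{i} b_i\otimes x_i\Big\|_{B\otimes_{\min}A}=\Big\|\sum_{i} b_i\otimes x_i\otimes\overline{x}_i\Big\|_{B\otimes_{\min}A\otimes_{\min}\overline{A}} .$$ Here $\otimes_{\min}$ is the minimal tensor product, $\overline{A}$ is the complex conjugate $C^*$-algebra of $A$ and $\overline{x}$ is $x$ viewed in $\overline{A}$. For $A=B(\ell^2(S))$, $\overline{A}$ is identified with $B(\ell^2(S))$ so that $\overline{x}$ is the entrywise complex conjugate matrix of $x$. *)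

theory Defs
  imports "HOL-Analysis.Analysis"
begin

section \<open>Complex vector spaces and abstract C*-algebras\<close>

class complex_vector = real_vector +
  fixes scaleC :: "complex \<Rightarrow> 'a \<Rightarrow> 'a" (infixr "*\<^sub>C" 75)
  assumes scaleC_add_right: "c *\<^sub>C (x + y) = c *\<^sub>C x + c *\<^sub>C y"
    and scaleC_add_left: "(c + d) *\<^sub>C x = c *\<^sub>C x + d *\<^sub>C x"
    and scaleC_scaleC: "c *\<^sub>C d *\<^sub>C x = (c * d) *\<^sub>C x"
    and scaleC_of_real: "of_real r *\<^sub>C x = r *\<^sub>R x"

text \<open>C*-algebras are not assumed to have a unit.\<close>

class cstar_algebra = real_normed_algebra + banach + complex_vector +
  fixes star :: "'a \<Rightarrow> 'a"
  assumes norm_scaleC: "norm (c *\<^sub>C x) = cmod c * norm x"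
    and scaleC_mult_left: "(c *\<^sub>C x) * y = c *\<^sub>C (x * y)"
    and scaleC_mult_right: "x * (c *\<^sub>C y) = c *\<^sub>C (x * y)"
    and star_add: "star (x + y) = star x + star y"
    and star_scaleC: "star (c *\<^sub>C x) = cnj c *\<^sub>C star x"
    and star_mult: "star (x * y) = star y * star x"
    and star_star: "star (star x) = x"
    and cstar_identity: "norm (star x * x) = (norm x)\<^sup>2"


section \<open>The Hilbert space of square-summable families indexed by a type\<close>

typedef 'x ell2 = "{f :: 'x \<Rightarrow> complex. (\<lambda>x. (cmod (f x))\<^sup>2) summable_on UNIV}"
  morphisms coord Abs_ell2
  by (rule exI[of _ "\<lambda>_. 0"]) simp

setup_lifting type_definition_ell2

lemma ell2_mult_abs_summable:
  fixes f g :: "'x \<Rightarrow> complex"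
  assumes "(\<lambda>x. (cmod (f x))\<^sup>2) summable_on UNIV" "(\<lambda>x. (cmod (g x))\<^sup>2) summable_on UNIV"
  shows "(\<lambda>x. cmod (cnj (f x) * g x)) summable_on UNIV"
proof (rule summable_on_comparison_test)
  show "(\<lambda>x. (cmod (f x))\<^sup>2 + (cmod (g x))\<^sup>2) summable_on UNIV"
    using assms by (rule summable_on_add)
next
  fix x
  have "2 * (cmod (f x) * cmod (g x)) \<le> (cmod (f x))\<^sup>2 + (cmod (g x))\<^sup>2"
    using sum_squares_bound[of "cmod (f x)" "cmod (g x)"] by simp
  moreover have "0 \<le> cmod (f x) * cmod (g x)" by simp
  ultimately show "cmod (cnj (f x) * g x) \<le> (cmod (f x))\<^sup>2 + (cmod (g x))\<^sup>2"
    unfolding norm_mult complex_mod_cnj by linarith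
qed simp

lemma ell2_mult_summable:
  fixes f g :: "'x \<Rightarrow> complex"
  assumes "(\<lambda>x. (cmod (f x))\<^sup>2) summable_on UNIV" "(\<lambda>x. (cmod (g x))\<^sup>2) summable_on UNIV"
  shows "(\<lambda>x. cnj (f x) * g x) summable_on UNIV"
  using ell2_mult_abs_summable[OF assms] by (rule abs_summable_summable)

lemma ell2_add_summable:
  fixes f g :: "'x \<Rightarrow> complex"
  assumes "(\<lambda>x. (cmod (f x))\<^sup>2) summable_on UNIV" "(\<lambda>x. (cmod (g x))\<^sup>2) summable_on UNIV"
  shows "(\<lambda>x. (cmod (f x + g x))\<^sup>2) summable_on UNIV"
proof (rule summable_on_comparison_test)
  show "(\<lambda>x. 2 * ((cmod (f x))\<^sup>2 + (cmod (g x))\<^sup>2)) summable_on UNIV"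
    using assms by (intro summable_on_cmult_right summable_on_add)
next
  fix x
  have "(cmod (f x + g x))\<^sup>2 \<le> (cmod (f x) + cmod (g x))\<^sup>2"
    by (intro power_mono norm_triangle_ineq) simp
  also have "\<dots> \<le> 2 * ((cmod (f x))\<^sup>2 + (cmod (g x))\<^sup>2)"
    using sum_squares_bound[of "cmod (f x)" "cmod (g x)"] by (simp add: power2_sum)
  finally show "(cmod (f x + g x))\<^sup>2 \<le> 2 * ((cmod (f x))\<^sup>2 + (cmod (g x))\<^sup>2)" .
qed simp

lemma ell2_scale_summable:
  fixes f :: "'x \<Rightarrow> complex"
  assumes "(\<lambda>x. (cmod (f x))\<^sup>2) summable_on UNIV"
  shows "(\<lambda>x. (cmod (c * f x))\<^sup>2) summable_on UNIV"
  using assms by (simp add: norm_mult power_mult_distrib summable_on_cmult_right)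

instantiation ell2 :: (type) complex_vector
begin

lift_definition zero_ell2 :: "'a ell2" is "\<lambda>_. 0" by simp

lift_definition plus_ell2 :: "'a ell2 \<Rightarrow> 'a ell2 \<Rightarrow> 'a ell2" is "\<lambda>f g x. f x + g x"
  by (rule ell2_add_summable)

lift_definition uminus_ell2 :: "'a ell2 \<Rightarrow> 'a ell2" is "\<lambda>f x. - f x" by simp

lift_definition minus_ell2 :: "'a ell2 \<Rightarrow> 'a ell2 \<Rightarrow> 'a ell2" is "\<lambda>f g x. f x - g x"
  using ell2_add_summable[of _ "\<lambda>x. - (h x)" for h] by simp

lift_definition scaleC_ell2 :: "complex \<Rightarrow> 'a ell2 \<Rightarrow> 'a ell2" is "\<lambda>c f x. c * f x"
  by (rule ell2_scale_summable)

definition scaleR_ell2 :: "real \<Rightarrow> 'a ell2 \<Rightarrow> 'a ell2"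
  where "scaleR_ell2 r f = of_real r *\<^sub>C f"

instance
  by standard (unfold scaleR_ell2_def, (transfer, auto simp: algebra_simps)+)

end

definition cinner :: "'x ell2 \<Rightarrow> 'x ell2 \<Rightarrow> complex"
  where "cinner f g = (\<Sum>\<^sub>\<infinity>x. cnj (coord f x) * coord g x)"

lemma coord_square_summable: "(\<lambda>x. (cmod (coord f x))\<^sup>2) summable_on UNIV"
  using coord[of f] by simp

lemma cinner_summable: "(\<lambda>x. cnj (coord f x) * coord g x) summable_on UNIV"
  by (intro ell2_mult_summable coord_square_summable)

lemma cinner_commute: "cinner f g = cnj (cinner g f)"
  unfolding cinner_def infsum_cnj[symmetric] by (simp add: mult.commute)

lemma cinner_add_left: "cinner (f + g) h = cinner f h + cinner g h"
  unfolding cinner_def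
  by (subst infsum_add[symmetric]) (simp_all only: cinner_summable plus_ell2.rep_eq complex_cnj_add distrib_right)

lemma cinner_scaleC_left: "cinner (c *\<^sub>C f) g = cnj c * cinner f g"
  unfolding cinner_def scaleC_ell2.rep_eq
  by (simp add: mult.assoc infsum_cmult_right cinner_summable)

lemma cinner_self: "cinner f f = of_real (\<Sum>\<^sub>\<infinity>x. (cmod (coord f x))\<^sup>2)"
proof -
  have "cinner f f = (\<Sum>\<^sub>\<infinity>x. of_real ((cmod (coord f x))\<^sup>2))"
    unfolding cinner_def by (simp only: complex_norm_square mult.commute)
  also have "\<dots> = of_real (\<Sum>\<^sub>\<infinity>x. (cmod (coord f x))\<^sup>2)"
    by (intro infsumI has_sum_of_real has_sum_infsum coord_square_summable)
  finally show ?thesis .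
qed

instantiation ell2 :: (type) real_inner
begin

definition inner_ell2 :: "'a ell2 \<Rightarrow> 'a ell2 \<Rightarrow> real"
  where "inner_ell2 f g = Re (cinner f g)"

definition norm_ell2 :: "'a ell2 \<Rightarrow> real"
  where "norm_ell2 f = sqrt (\<Sum>\<^sub>\<infinity>x. (cmod (coord f x))\<^sup>2)"

definition sgn_ell2 :: "'a ell2 \<Rightarrow> 'a ell2"
  where "sgn_ell2 f = f /\<^sub>R norm f"

definition dist_ell2 :: "'a ell2 \<Rightarrow> 'a ell2 \<Rightarrow> real"
  where "dist_ell2 f g = norm (f - g)"

definition uniformity_ell2 :: "('a ell2 \<times> 'a ell2) filter"
  where "uniformity_ell2 = (INF e\<in>{0<..}. principal {(f, g). dist f g < e})"

definition open_ell2 :: "'a ell2 set \<Rightarrow> bool"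
  where "open_ell2 U \<longleftrightarrow> (\<forall>f\<in>U. eventually (\<lambda>(f', g). f' = f \<longrightarrow> g \<in> U) uniformity)"

instance
proof
  fix f g h :: "'a ell2" and r :: real and U :: "'a ell2 set"
  show "sgn f = f /\<^sub>R norm f" by (rule sgn_ell2_def)
  show "dist f g = norm (f - g)" by (rule dist_ell2_def)
  show "(uniformity :: ('a ell2 \<times> 'a ell2) filter)
      = (INF e\<in>{0<..}. principal {(f, g). dist f g < e})" by (rule uniformity_ell2_def)
  show "open U \<longleftrightarrow> (\<forall>f\<in>U. eventually (\<lambda>(f', g). f' = f \<longrightarrow> g \<in> U) uniformity)"
    by (rule open_ell2_def)
  show "inner f g = inner g f"
    unfolding inner_ell2_def by (subst cinner_commute) simp
  show "inner (f + g) h = inner f h + inner g h"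
    by (simp add: inner_ell2_def cinner_add_left)
  show "inner (r *\<^sub>R f) g = r * inner f g"
    by (simp add: inner_ell2_def scaleR_ell2_def cinner_scaleC_left)
  show "0 \<le> inner f f"
    by (simp add: inner_ell2_def cinner_self infsum_nonneg)
  show "inner f f = 0 \<longleftrightarrow> f = 0"
  proof
    assume "inner f f = 0"
    then have *: "(\<Sum>\<^sub>\<infinity>x. (cmod (coord f x))\<^sup>2) = 0"
      by (simp add: inner_ell2_def cinner_self)
    have "coord f x = 0" for x
      using nonneg_infsum_le_0D[OF _ coord_square_summable, of f x] * by simp
    then show "f = 0" by (simp add: coord_inject[symmetric] zero_ell2.rep_eq fun_eq_iff)
  qed (simp add: inner_ell2_def cinner_self zero_ell2.rep_eq)
  show "norm f = sqrt (inner f f)"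
    by (simp add: norm_ell2_def inner_ell2_def cinner_self)
qed

end


section \<open>Operators\<close>

definition bounded_clinear :: "('x ell2 \<Rightarrow> 'y ell2) \<Rightarrow> bool"
  where "bounded_clinear T \<longleftrightarrow> bounded_linear T \<and> (\<forall>c f. T (c *\<^sub>C f) = c *\<^sub>C T f)"

text \<open>The Hilbert space tensor product of the spaces over \<^typ>\<open>'x\<close> and \<^typ>\<open>'y\<close> is the one
  over \<^typ>\<open>'x \<times> 'y\<close>.\<close>

lift_definition tensor_ell2 :: "'x ell2 \<Rightarrow> 'y ell2 \<Rightarrow> ('x \<times> 'y) ell2" (infixr "\<otimes>\<^sub>v" 70)
  is "\<lambda>f g (x, y). f x * g y"
proof -
  fix f :: "'x \<Rightarrow> complex" and g :: "'y \<Rightarrow> complex"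
  assume "(\<lambda>x. (cmod (f x))\<^sup>2) summable_on UNIV" "(\<lambda>y. (cmod (g y))\<^sup>2) summable_on UNIV"
  then have "(\<lambda>(x, y). (cmod (f x))\<^sup>2 * (cmod (g y))\<^sup>2) summable_on UNIV \<times> UNIV"
    by (intro summable_on_SigmaI[where g = "\<lambda>x. (cmod (f x))\<^sup>2 * (\<Sum>\<^sub>\<infinity>y. (cmod (g y))\<^sup>2)"])
       (auto intro!: has_sum_cmult_right has_sum_infsum summable_on_cmult_left)
  then show "(\<lambda>p. (cmod (case p of (x, y) \<Rightarrow> f x * g y))\<^sup>2) summable_on UNIV"
    by (simp add: case_prod_unfold norm_mult power_mult_distrib)
qed

text \<open>For bounded \<open>T\<close> and \<open>U\<close> there is exactly one such operator; elementary tensors span a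
  dense subspace.\<close>

definition tensor_op :: "('x ell2 \<Rightarrow> 'x ell2) \<Rightarrow> ('y ell2 \<Rightarrow> 'y ell2) \<Rightarrow>
    (('x \<times> 'y) ell2 \<Rightarrow> ('x \<times> 'y) ell2)" (infixr "\<otimes>\<^sub>o" 70)
  where "T \<otimes>\<^sub>o U = (THE W. bounded_clinear W \<and> (\<forall>f g. W (f \<otimes>\<^sub>v g) = T f \<otimes>\<^sub>v U g))"

lift_definition conj_ell2 :: "'x ell2 \<Rightarrow> 'x ell2" is "\<lambda>f x. cnj (f x)" by simp

text \<open>The matrix of \<open>conj_op T\<close> is the entrywise complex conjugate of the matrix of \<open>T\<close>.\<close>

definition conj_op :: "('x ell2 \<Rightarrow> 'x ell2) \<Rightarrow> ('x ell2 \<Rightarrow> 'x ell2)"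
  where "conj_op T f = conj_ell2 (T (conj_ell2 f))"


section \<open>The minimal tensor norm\<close>

text \<open>Representations may be degenerate and need not be faithful; they are automatically
  contractive.\<close>

definition star_representation :: "('b::cstar_algebra \<Rightarrow> 'x ell2 \<Rightarrow> 'x ell2) \<Rightarrow> bool"
  where "star_representation \<pi> \<longleftrightarrow>
    (\<forall>b. bounded_clinear (\<pi> b)) \<and>
    (\<forall>a b f. \<pi> (a + b) f = \<pi> a f + \<pi> b f) \<and>
    (\<forall>c b f. \<pi> (c *\<^sub>C b) f = c *\<^sub>C \<pi> b f) \<and>
    (\<forall>a b f. \<pi> (a * b) f = \<pi> a (\<pi> b f)) \<and>
    (\<forall>b f g. cinner (\<pi> (star b) f) g = cinner f (\<pi> b g))"

text \<open>The norm of \<open>\<Sum>i. b i \<otimes> x i\<close> in \<open>B \<otimes>\<^sub>m\<^sub>i\<^sub>n A\<close>, for a C*-algebra \<open>B\<close> of type \<^typ>\<open>'b\<close>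
  and a concretely represented C*-algebra \<open>A\<close>, that is, a C*-subalgebra of the bounded operators
  on \<^typ>\<open>'s ell2\<close>: the supremum over the representations of \<open>B\<close>, with \<open>A\<close> in its identity
  representation, of the operator norm on the Hilbert space tensor product. It does not depend on
  the choice of \<open>A\<close>, and any faithful representation of \<open>B\<close> attains it. The Hilbert space
  \<^typ>\<open>'b ell2\<close> is large enough: every representation of \<open>B\<close> is a direct sum of cyclic and
  zero ones, a cyclic one has a dense subset of cardinality at most that of \<open>B\<close>, and
  a representation on a smaller space can be extended by zero.\<close>

definition min_tensor_norm ::
    "('i \<Rightarrow> 'b::cstar_algebra) \<Rightarrow> ('i \<Rightarrow> 's ell2 \<Rightarrow> 's ell2) \<Rightarrow> real"
  where "min_tensor_norm b x =
    (SUP \<pi>\<in>{\<pi> :: 'b \<Rightarrow> 'b ell2 \<Rightarrow> 'b ell2. star_representation \<pi>}.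
      onorm (\<lambda>f. \<Sum>i | b i \<noteq> 0. (\<pi> (b i) \<otimes>\<^sub>o x i) f))"


section \<open>Self-absorption\<close>

text \<open>The coefficient algebra \<open>B\<close> ranges over all C*-algebras by letting the type \<^typ>\<open>'b\<close> vary.
  The conjugate of \<open>A\<close> is represented on \<^typ>\<open>'s ell2\<close> as well, so that the spatial tensor
  product of \<open>A\<close> with its conjugate acts on \<^typ>\<open>('s \<times> 's) ell2\<close>.\<close>

definition SAP :: "'b::cstar_algebra itself \<Rightarrow> ('i \<Rightarrow> 's ell2 \<Rightarrow> 's ell2) \<Rightarrow> bool"
  where "SAP _ x \<longleftrightarrow> (\<forall>i. bounded_clinear (x i)) \<and>
    (\<forall>b :: 'i \<Rightarrow> 'b. finite {i. b i \<noteq> 0} \<longrightarrow>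
      min_tensor_norm b x = min_tensor_norm b (\<lambda>i. x i \<otimes>\<^sub>o conj_op (x i)))"

lift_definition proj_ell2 :: "'x set \<Rightarrow> 'x ell2 \<Rightarrow> 'x ell2"
  is "\<lambda>S f x. if x \<in> S then f x else 0"
  by (rule summable_on_comparison_test) auto

definition hereditary_SAP :: "'b::cstar_algebra itself \<Rightarrow> ('i \<Rightarrow> 's ell2 \<Rightarrow> 's ell2) \<Rightarrow> bool"
  where "hereditary_SAP B x \<longleftrightarrow>
    (\<forall>S\<^sub>1 S\<^sub>2. SAP B (\<lambda>i. proj_ell2 S\<^sub>1 \<circ> x i \<circ> proj_ell2 S\<^sub>2))"

text \<open>The group is written additively (\<^class>\<open>group_add\<close> is not commutative):
  \<open>(\<lambda>(g) f)(x) = f(g\<^sup>-\<^sup>1 x)\<close>.\<close>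

lift_definition left_regular :: "'g::group_add \<Rightarrow> 'g ell2 \<Rightarrow> 'g ell2"
  is "\<lambda>g f x. f (- g + x)"
proof -
  fix g :: 'g and f :: "'g \<Rightarrow> complex"
  assume f: "(\<lambda>x. (cmod (f x))\<^sup>2) summable_on UNIV"
  have "bij_betw (\<lambda>x. - g + x) UNIV UNIV"
    by (rule bij_betwI[where g = "\<lambda>x. g + x"]) (auto simp: add.assoc[symmetric])
  from summable_on_reindex_bij_betw[OF this, of "\<lambda>x. (cmod (f x))\<^sup>2"] f
  show "(\<lambda>x. (cmod (f (- g + x)))\<^sup>2) summable_on UNIV" by simp
qed

end

theory Submission
  imports Defs
begin

text \<open>
  Fix a representation \<open>\<pi>\<close> of the coefficient algebra and write \<open>A g = \<pi> (b g)\<close> and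
  \<open>x g = P\<^bsub>S\<^sub>1\<^esub> \<lambda>(g) P\<^bsub>S\<^sub>2\<^esub>\<close>. Already the operator norms of
  \<open>T = \<Sum>g. A g \<otimes> x g\<close> (\<open>plain_op\<close>) and \<open>U = \<Sum>g. A g \<otimes> x g \<otimes> conj (x g)\<close> (\<open>absorbed_op\<close>)
  agree, so that the suprema over all \<open>\<pi>\<close>, which are the minimal tensor norms, agree too.

  The matrix of \<open>x g\<close> has entries \<open>0\<close> and \<open>1\<close>, so conjugation does nothing to it, and
  \<open>x g \<otimes> x g\<close> is a compression of the diagonal left translation of \<open>G \<times> G\<close> by \<open>g\<close>. That
  translation preserves each orbit \<open>{(s, s + k) | s}\<close>, and the orbit is a copy of \<open>G\<close> via its first
  coordinate. Hence \<open>U\<close> is the orthogonal direct sum over \<open>k\<close> of operators \<open>Q T Q'\<close>, where the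
  projections \<open>Q\<close> and \<open>Q'\<close> record the conditions that \<open>S\<^sub>1\<close> and \<open>S\<^sub>2\<close> impose on the second
  coordinate (\<open>diagonal_absorbed_op\<close>). So \<open>\<parallel>U\<parallel> \<le> \<parallel>T\<parallel>\<close>. For \<open>k = 0\<close> both coordinates are equal
  and the cut-downs are vacuous, so \<open>T\<close> itself is one of the summands and \<open>\<parallel>T\<parallel> \<le> \<parallel>U\<parallel>\<close>.

  Compressed translations, restrictions to an orbit, slices and embeddings of a summand all
  pull a family back along a partially defined injection of index sets, so one operator,
  \<open>pullback\<close>, serves for all of them. A tensor product with such an operator is computed in
  coordinates by \<open>tensor_op_pullback\<close>.
\<close>


section \<open>Bounded operators on spaces of square-summable families\<close>

lemma ell2_eqI: "(\<And>x. coord f x = coord g x) \<Longrightarrow> f = g"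
  by (simp add: coord_inject[symmetric] fun_eq_iff)

lemma norm_ell2_has_sum: "((\<lambda>x. (cmod (coord f x))\<^sup>2) has_sum (norm f)\<^sup>2) UNIV"
proof -
  have "(norm f)\<^sup>2 = (\<Sum>\<^sub>\<infinity>x. (cmod (coord f x))\<^sup>2)"
    by (simp add: norm_ell2_def infsum_nonneg)
  then show ?thesis
    using coord_square_summable[of f] by simp
qed

lemma coord_sum: "coord (\<Sum>i\<in>I. f i) x = (\<Sum>i\<in>I. coord (f i) x)"
  by (induction I rule: infinite_finite_induct) (auto simp: zero_ell2.rep_eq plus_ell2.rep_eq)

lemma bounded_clinearI:
  assumes "\<And>f g. T (f + g) = T f + T g" "\<And>c f. T (c *\<^sub>C f) = c *\<^sub>C T f"
    and "\<And>f. norm (T f) \<le> norm f * K"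
  shows "bounded_clinear T"
  unfolding bounded_clinear_def
  by (auto intro!: bounded_linear_intro[where K = K] simp: assms scaleR_ell2_def)

lemma bounded_clinearD:
  assumes "bounded_clinear T"
  shows "bounded_linear T" "T (f + g) = T f + T g" "T (c *\<^sub>C f) = c *\<^sub>C T f" "T 0 = 0"
  using assms by (auto simp: bounded_clinear_def linear_simps)

lemma bounded_clinear_compose:
  assumes "bounded_clinear T" "bounded_clinear U"
  shows "bounded_clinear (T \<circ> U)"
  using assms bounded_linear_compose[of T U] by (auto simp: bounded_clinear_def o_def)

definition pullback :: "'x set \<Rightarrow> ('x \<Rightarrow> 'y) \<Rightarrow> 'y ell2 \<Rightarrow> 'x ell2"
  where "pullback D \<phi> f = Abs_ell2 (\<lambda>x. if x \<in> D then coord f (\<phi> x) else 0)"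

lemma pullback_summable:
  assumes "inj_on \<phi> D"
  shows "(\<lambda>x. (cmod (if x \<in> D then coord f (\<phi> x) else 0))\<^sup>2) summable_on UNIV"
proof -
  have "(\<lambda>y. (cmod (coord f y))\<^sup>2) summable_on (\<phi> ` D)"
    using coord_square_summable[of f] by (rule summable_on_subset_banach) simp
  then have "(\<lambda>x. (cmod (coord f (\<phi> x)))\<^sup>2) summable_on D"
    by (simp add: summable_on_reindex[OF assms] o_def)
  then show ?thesis
    by (rule summable_on_cong_neutral[THEN iffD1, rotated -1]) auto
qed

lemma coord_pullback:
  assumes "inj_on \<phi> D"
  shows "coord (pullback D \<phi> f) x = (if x \<in> D then coord f (\<phi> x) else 0)"
  unfolding pullback_def using pullback_summable[OF assms] by (subst Abs_ell2_inverse) auto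

lemma norm_pullback_le:
  assumes "inj_on \<phi> D"
  shows "norm (pullback D \<phi> f) \<le> norm f"
proof -
  have "((\<lambda>x. (cmod (coord (pullback D \<phi> f) x))\<^sup>2) has_sum (norm (pullback D \<phi> f))\<^sup>2) UNIV"
    by (rule norm_ell2_has_sum)
  then have "((\<lambda>x. (cmod (coord f (\<phi> x)))\<^sup>2) has_sum (norm (pullback D \<phi> f))\<^sup>2) D"
    by (rule has_sum_cong_neutral[THEN iffD1, rotated -1]) (auto simp: coord_pullback[OF assms])
  then have "((\<lambda>y. (cmod (coord f y))\<^sup>2) has_sum (norm (pullback D \<phi> f))\<^sup>2) (\<phi> ` D)"
    by (simp add: has_sum_reindex[OF assms] o_def)
  from has_sum_mono2[OF this norm_ell2_has_sum]
  have "(norm (pullback D \<phi> f))\<^sup>2 \<le> (norm f)\<^sup>2" by simp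
  then show ?thesis by (rule power2_le_imp_le) simp
qed

lemma bounded_clinear_pullback:
  assumes "inj_on \<phi> D"
  shows "bounded_clinear (pullback D \<phi>)"
proof (rule bounded_clinearI[where K = 1])
  show "norm (pullback D \<phi> f) \<le> norm f * 1" for f
    using norm_pullback_le[OF assms] by simp
qed (auto intro!: ell2_eqI simp: coord_pullback[OF assms] plus_ell2.rep_eq scaleC_ell2.rep_eq)

lemma norm_proj_ell2_le: "norm (proj_ell2 S f) \<le> norm f"
proof -
  have "proj_ell2 S f = pullback S id f"
    by (rule ell2_eqI) (simp add: proj_ell2.rep_eq coord_pullback)
  then show ?thesis using norm_pullback_le[of id S f] by simp
qed

text \<open>A partition of the index set into copies of \<^typ>\<open>'x\<close> decomposes the Hilbert space
  orthogonally. Both the slices of a tensor product and the orbits in \<open>G \<times> G\<close> arise in this way.\<close>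

lemma norm_fibres_has_sum:
  assumes "bij h"
  shows "((\<lambda>i. (norm (pullback UNIV (\<lambda>x. h (i, x)) f))\<^sup>2) has_sum (norm f)\<^sup>2) UNIV"
proof (rule has_sum_SigmaD)
  have "((\<lambda>p. (cmod (coord f (h p)))\<^sup>2) has_sum (norm f)\<^sup>2) UNIV"
    unfolding has_sum_reindex_bij_betw[OF assms, where f = "\<lambda>y. (cmod (coord f y))\<^sup>2"]
    by (rule norm_ell2_has_sum)
  then show "((\<lambda>p. (cmod (coord f (h p)))\<^sup>2) has_sum (norm f)\<^sup>2) (UNIV \<times> UNIV)"
    by simp
  fix i
  have "inj (\<lambda>x. h (i, x))"
    using bij_is_inj[OF assms] by (auto simp: inj_on_def)
  then show "((\<lambda>x. (cmod (coord f (h (i, x))))\<^sup>2)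
      has_sum (norm (pullback UNIV (\<lambda>x. h (i, x)) f))\<^sup>2) UNIV"
    using norm_ell2_has_sum[of "pullback UNIV (\<lambda>x. h (i, x)) f"] by (simp add: coord_pullback)
qed


section \<open>Operators are determined by their values on the standard basis\<close>

lift_definition ket :: "'x \<Rightarrow> 'x ell2" is "\<lambda>p x. if x = p then 1 else 0"
proof -
  fix p :: 'x
  have "(\<lambda>x. (cmod (if x = p then 1 else 0))\<^sup>2) summable_on {p}" by simp
  then show "(\<lambda>x. (cmod (if x = p then 1 else 0))\<^sup>2) summable_on UNIV"
    by (rule summable_on_cong_neutral[THEN iffD1, rotated -1]) auto
qed

lemma ket_tensor: "ket a \<otimes>\<^sub>v ket s = ket (a, s)"
  by (rule ell2_eqI) (auto simp: tensor_ell2.rep_eq ket.rep_eq split: if_splits)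

lemma proj_finite_eq_sum:
  assumes "finite K"
  shows "proj_ell2 K f = (\<Sum>p\<in>K. coord f p *\<^sub>C ket p)"
  by (rule ell2_eqI)
     (simp add: proj_ell2.rep_eq coord_sum scaleC_ell2.rep_eq ket.rep_eq if_distrib assms cong: if_cong)

text \<open>The squared distance to a finite truncation is a tail of the convergent series for the squared
  norm.\<close>

lemma proj_finite_tendsto: "((\<lambda>K. proj_ell2 K f) \<longlongrightarrow> f) (finite_subsets_at_top UNIV)"
proof -
  have eq: "(norm (proj_ell2 K f - f))\<^sup>2 = (norm f)\<^sup>2 - (\<Sum>x\<in>K. (cmod (coord f x))\<^sup>2)"
    if "finite K" for K
  proof (rule has_sum_unique)
    show "((\<lambda>x. (cmod (coord (proj_ell2 K f - f) x))\<^sup>2)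
        has_sum (norm (proj_ell2 K f - f))\<^sup>2) UNIV"
      by (rule norm_ell2_has_sum)
    have "((\<lambda>x. (cmod (coord f x))\<^sup>2) has_sum
        (norm f)\<^sup>2 - (\<Sum>x\<in>K. (cmod (coord f x))\<^sup>2)) (UNIV - K)"
      by (intro has_sum_Diff norm_ell2_has_sum has_sum_finite that) simp
    then show "((\<lambda>x. (cmod (coord (proj_ell2 K f - f) x))\<^sup>2)
        has_sum (norm f)\<^sup>2 - (\<Sum>x\<in>K. (cmod (coord f x))\<^sup>2)) UNIV"
      by (rule has_sum_cong_neutral[THEN iffD1, rotated -1])
         (auto simp: minus_ell2.rep_eq proj_ell2.rep_eq)
  qed
  have "((\<lambda>K. (norm f)\<^sup>2 - (\<Sum>x\<in>K. (cmod (coord f x))\<^sup>2)) \<longlongrightarrow> (norm f)\<^sup>2 - (norm f)\<^sup>2)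
      (finite_subsets_at_top UNIV)"
    using norm_ell2_has_sum[of f] by (intro tendsto_intros) (simp add: has_sum_def)
  then have "((\<lambda>K. (norm (proj_ell2 K f - f))\<^sup>2) \<longlongrightarrow> 0) (finite_subsets_at_top UNIV)"
    by (rule Lim_transform_eventually[OF _ eventually_finite_subsets_at_top_weakI, THEN tendsto_eq_rhs])
       (simp_all add: eq)
  from tendsto_real_sqrt[OF this]
  have "((\<lambda>K. norm (proj_ell2 K f - f)) \<longlongrightarrow> 0) (finite_subsets_at_top UNIV)" by simp
  then show ?thesis using Lim_null tendsto_norm_zero_iff by blast
qed

lemma bounded_clinear_eqI:
  assumes "bounded_clinear T" "bounded_clinear U" and ket: "\<And>p. T (ket p) = U (ket p)"
  shows "T = U"
proof
  fix f
  let ?F = "finite_subsets_at_top UNIV"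
  have "T (proj_ell2 K f) = U (proj_ell2 K f)" if "finite K" for K
    using assms(1,2)[THEN bounded_clinearD(1), THEN bounded_linear.linear] that
    by (simp add: proj_finite_eq_sum linear_sum bounded_clinearD(3)[OF assms(1)]
        bounded_clinearD(3)[OF assms(2)] ket)
  then have "eventually (\<lambda>K. T (proj_ell2 K f) = U (proj_ell2 K f)) ?F"
    by (intro eventually_finite_subsets_at_top_weakI)
  moreover have "((\<lambda>K. T (proj_ell2 K f)) \<longlongrightarrow> T f) ?F" "((\<lambda>K. U (proj_ell2 K f)) \<longlongrightarrow> U f) ?F"
    by (intro bounded_linear.tendsto[OF _ proj_finite_tendsto] bounded_clinearD(1) assms)+
  ultimately show "T f = U f"
    using finite_subsets_at_top_neq_bot tendsto_unique Lim_transform_eventually by metis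
qed

text \<open>The basis vectors of a tensor product are elementary tensors, so any bounded operator with the
  required values on elementary tensors is the one that the definite description selects.\<close>

lemma tensor_op_eqI:
  assumes "bounded_clinear W" "\<And>f g. W (f \<otimes>\<^sub>v g) = T f \<otimes>\<^sub>v U g"
  shows "T \<otimes>\<^sub>o U = W"
  unfolding tensor_op_def
proof (rule the_equality)
  fix W' assume "bounded_clinear W' \<and> (\<forall>f g. W' (f \<otimes>\<^sub>v g) = T f \<otimes>\<^sub>v U g)"
  then have W': "bounded_clinear W'" "\<And>f g. W' (f \<otimes>\<^sub>v g) = T f \<otimes>\<^sub>v U g" by auto
  show "W' = W"
  proof (rule bounded_clinear_eqI[OF W'(1) assms(1)])
    fix p
    show "W' (ket p) = W (ket p)"
      using W'(2) assms(2) by (cases p) (metis ket_tensor)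
  qed
qed (use assms in auto)


section \<open>Tensor products with pullback operators\<close>

definition slice :: "'s \<Rightarrow> ('x \<times> 's) ell2 \<Rightarrow> 'x ell2"
  where "slice s = pullback UNIV (\<lambda>a. (a, s))"

lemma coord_slice: "coord (slice s F) a = coord F (a, s)"
  unfolding slice_def by (subst coord_pullback) (auto simp: inj_on_def)

lemma slice_add: "slice s (F + F') = slice s F + slice s F'"
  and slice_scaleC: "slice s (c *\<^sub>C F) = c *\<^sub>C slice s F"
  and slice_tensor: "slice s (f \<otimes>\<^sub>v g) = coord g s *\<^sub>C f"
  by (auto intro!: ell2_eqI
      simp: coord_slice plus_ell2.rep_eq scaleC_ell2.rep_eq tensor_ell2.rep_eq)

lemma norm_slices_has_sum: "((\<lambda>s. (norm (slice s F))\<^sup>2) has_sum (norm F)\<^sup>2) UNIV"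
  using norm_fibres_has_sum[of prod.swap F] by (simp add: slice_def)

text \<open>This is \<open>A \<otimes> 1\<close>: it applies \<open>A\<close> to every slice, which makes its boundedness a
  consequence of the orthogonality of the slices.\<close>

definition ampliation :: "('x ell2 \<Rightarrow> 'x ell2) \<Rightarrow> ('x \<times> 's) ell2 \<Rightarrow> ('x \<times> 's) ell2"
  where "ampliation A F = Abs_ell2 (\<lambda>(a, s). coord (A (slice s F)) a)"

context
  fixes A :: "'x ell2 \<Rightarrow> 'x ell2"
  assumes A: "bounded_clinear A"
begin

lemma norm_ampliated_slice_le: "(norm (A (slice s F)))\<^sup>2 \<le> (onorm A)\<^sup>2 * (norm (slice s F))\<^sup>2"
proof -
  have "norm (A (slice s F)) \<le> onorm A * norm (slice s F)"
    by (rule onorm[OF bounded_clinearD(1)[OF A]])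
  then have "(norm (A (slice s F)))\<^sup>2 \<le> (onorm A * norm (slice s F))\<^sup>2"
    by (rule power_mono) simp
  then show ?thesis by (simp add: power_mult_distrib)
qed

lemma coord_ampliation: "coord (ampliation A F) (a, s) = coord (A (slice s F)) a"
proof -
  have "(\<lambda>s. (onorm A)\<^sup>2 * (norm (slice s F))\<^sup>2) summable_on UNIV"
    by (intro summable_on_cmult_right has_sum_imp_summable[OF norm_slices_has_sum])
  then have "(\<lambda>s. (norm (A (slice s F)))\<^sup>2) summable_on UNIV"
    by (rule summable_on_comparison_test) (auto intro: norm_ampliated_slice_le)
  then have "(\<lambda>(s, a). (cmod (coord (A (slice s F)) a))\<^sup>2) summable_on UNIV \<times> UNIV"
    by (rule summable_on_SigmaI[rotated]) (auto intro: norm_ell2_has_sum)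
  then have "(\<lambda>(a, s). (cmod (coord (A (slice s F)) a))\<^sup>2) summable_on UNIV"
    by (subst (asm) summable_on_swap) simp
  then show ?thesis
    unfolding ampliation_def by (subst Abs_ell2_inverse) (auto simp: case_prod_unfold)
qed

lemma slice_ampliation: "slice s (ampliation A F) = A (slice s F)"
  by (rule ell2_eqI) (simp add: coord_slice coord_ampliation)

lemma bounded_clinear_ampliation: "bounded_clinear (ampliation A)"
proof (rule bounded_clinearI[where K = "onorm A"])
  fix F
  have "((\<lambda>s. (norm (A (slice s F)))\<^sup>2) has_sum (norm (ampliation A F))\<^sup>2) UNIV"
    using norm_slices_has_sum[of "ampliation A F"] by (simp add: slice_ampliation)
  moreover have "((\<lambda>s. (onorm A)\<^sup>2 * (norm (slice s F))\<^sup>2) has_sum (onorm A)\<^sup>2 * (norm F)\<^sup>2) UNIV"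
    by (intro has_sum_cmult_right norm_slices_has_sum)
  ultimately have "(norm (ampliation A F))\<^sup>2 \<le> (onorm A)\<^sup>2 * (norm F)\<^sup>2"
    by (rule has_sum_mono) (rule norm_ampliated_slice_le)
  then have "(norm (ampliation A F))\<^sup>2 \<le> (norm F * onorm A)\<^sup>2"
    by (simp add: power_mult_distrib mult.commute)
  then show "norm (ampliation A F) \<le> norm F * onorm A"
    by (rule power2_le_imp_le)
       (simp add: onorm_pos_le[OF bounded_clinearD(1)[OF A]])
qed (auto intro!: ell2_eqI simp: coord_ampliation plus_ell2.rep_eq scaleC_ell2.rep_eq
      slice_add slice_scaleC bounded_clinearD[OF A])

text \<open>The tensor product factors as \<open>(A \<otimes> 1) (1 \<otimes> pullback D \<phi>)\<close>, and its second factor is again a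
  pullback.\<close>

lemma tensor_op_pullback:
  assumes "inj_on \<phi> D"
  shows "bounded_clinear (A \<otimes>\<^sub>o pullback D \<phi>)"
    and "coord ((A \<otimes>\<^sub>o pullback D \<phi>) F) (a, s)
      = (if s \<in> D then coord (A (slice (\<phi> s) F)) a else 0)"
proof -
  let ?P = "pullback (UNIV \<times> D) (\<lambda>(a::'x, s). (a, \<phi> s))"
  have inj: "inj_on (\<lambda>(a::'x, s). (a, \<phi> s)) (UNIV \<times> D)"
    using assms by (auto simp: inj_on_def)
  have slice_P: "slice s (?P F) = (if s \<in> D then slice (\<phi> s) F else 0)" for s F
    by (rule ell2_eqI) (auto simp: coord_slice coord_pullback[OF inj] zero_ell2.rep_eq)
  have bdd: "bounded_clinear (ampliation A \<circ> ?P)"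
    by (intro bounded_clinear_compose bounded_clinear_ampliation bounded_clinear_pullback inj)
  have coord: "coord ((ampliation A \<circ> ?P) F) (a, s)
      = (if s \<in> D then coord (A (slice (\<phi> s) F)) a else 0)" for F a s
    by (simp add: coord_ampliation slice_P bounded_clinearD(4)[OF A] zero_ell2.rep_eq)
  have eq: "A \<otimes>\<^sub>o pullback D \<phi> = ampliation A \<circ> ?P"
  proof (rule tensor_op_eqI[OF bdd], rule ell2_eqI)
    fix f g p
    show "coord ((ampliation A \<circ> ?P) (f \<otimes>\<^sub>v g)) p = coord (A f \<otimes>\<^sub>v pullback D \<phi> g) p"
      by (cases p) (simp del: o_apply add: coord slice_tensor bounded_clinearD(3)[OF A]
          tensor_ell2.rep_eq scaleC_ell2.rep_eq coord_pullback[OF assms])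
  qed
  show "bounded_clinear (A \<otimes>\<^sub>o pullback D \<phi>)" unfolding eq by (rule bdd)
  show "coord ((A \<otimes>\<^sub>o pullback D \<phi>) F) (a, s)
      = (if s \<in> D then coord (A (slice (\<phi> s) F)) a else 0)" unfolding eq by (rule coord)
qed

end

text \<open>The matrix of a pullback is real.\<close>

lemma conj_op_pullback:
  assumes "inj_on \<phi> D"
  shows "conj_op (pullback D \<phi>) = pullback D \<phi>"
  by (intro ext ell2_eqI) (simp add: conj_op_def conj_ell2.rep_eq coord_pullback[OF assms])

lemma tensor_op_pullback_pullback:
  assumes "inj_on \<phi> D" "inj_on \<psi> E"
  shows "pullback D \<phi> \<otimes>\<^sub>o pullback E \<psi> = pullback (D \<times> E) (map_prod \<phi> \<psi>)"
proof (rule tensor_op_eqI)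
  have inj: "inj_on (map_prod \<phi> \<psi>) (D \<times> E)"
    using assms by (rule map_prod_inj_on)
  show "bounded_clinear (pullback (D \<times> E) (map_prod \<phi> \<psi>))"
    by (rule bounded_clinear_pullback[OF inj])
  show "pullback (D \<times> E) (map_prod \<phi> \<psi>) (f \<otimes>\<^sub>v g) = pullback D \<phi> f \<otimes>\<^sub>v pullback E \<psi> g" for f g
    by (rule ell2_eqI)
       (auto simp: coord_pullback[OF inj] tensor_ell2.rep_eq coord_pullback[OF assms(1)]
          coord_pullback[OF assms(2)] split: if_splits)
qed


section \<open>Compressed left translations\<close>

text \<open>The indices of the nonzero rows of the matrix of \<open>P\<^bsub>S\<^sub>1\<^esub> \<lambda>(g) P\<^bsub>S\<^sub>2\<^esub>\<close>: left translation by
  \<open>g\<close> pulls back along \<open>s \<mapsto> - g + s\<close>, and \<open>S\<^sub>2\<close> constrains the point at which the family is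
  evaluated.\<close>

definition compressed_dom :: "'g::group_add set \<Rightarrow> 'g set \<Rightarrow> 'g \<Rightarrow> 'g set"
  where "compressed_dom S\<^sub>1 S\<^sub>2 g = {s \<in> S\<^sub>1. - g + s \<in> S\<^sub>2}"

lemma inj_on_translation: "inj_on ((+) (- g)) D" for g :: "'g::group_add"
  by (auto simp: inj_on_def)

lemma compressed_left_regular:
  "proj_ell2 S\<^sub>1 \<circ> left_regular g \<circ> proj_ell2 S\<^sub>2 = pullback (compressed_dom S\<^sub>1 S\<^sub>2 g) ((+) (- g))"
  by (intro ext ell2_eqI)
     (simp add: proj_ell2.rep_eq left_regular.rep_eq coord_pullback[OF inj_on_translation]
        compressed_dom_def)

context
  fixes A :: "'g::group_add \<Rightarrow> 'x ell2 \<Rightarrow> 'x ell2" and I :: "'g set" and S\<^sub>1 S\<^sub>2 :: "'g set"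
  assumes A: "\<And>g. bounded_clinear (A g)"
begin

abbreviation (input) translation :: "'g \<Rightarrow> 'g ell2 \<Rightarrow> 'g ell2"
  where "translation g \<equiv> pullback (compressed_dom S\<^sub>1 S\<^sub>2 g) ((+) (- g))"

definition plain_op :: "('x \<times> 'g) ell2 \<Rightarrow> ('x \<times> 'g) ell2"
  where "plain_op F = (\<Sum>g\<in>I. (A g \<otimes>\<^sub>o translation g) F)"

definition absorbed_op :: "('x \<times> 'g \<times> 'g) ell2 \<Rightarrow> ('x \<times> 'g \<times> 'g) ell2"
  where "absorbed_op F = (\<Sum>g\<in>I. (A g \<otimes>\<^sub>o (translation g \<otimes>\<^sub>o conj_op (translation g))) F)"

lemma inj_on_translation_pair: "inj_on (map_prod ((+) (- g)) ((+) (- g))) D" for g :: 'g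
  by (auto simp: inj_on_def)

lemma absorbed_op_summand:
  "translation g \<otimes>\<^sub>o conj_op (translation g)
    = pullback (compressed_dom S\<^sub>1 S\<^sub>2 g \<times> compressed_dom S\<^sub>1 S\<^sub>2 g) (map_prod ((+) (- g)) ((+) (- g)))"
  by (simp add: conj_op_pullback[OF inj_on_translation]
      tensor_op_pullback_pullback[OF inj_on_translation inj_on_translation])

lemma coord_plain_op:
  "coord (plain_op F) (a, s) = (\<Sum>g\<in>I. if s \<in> compressed_dom S\<^sub>1 S\<^sub>2 g
    then coord (A g (slice (- g + s) F)) a else 0)"
  by (simp add: plain_op_def coord_sum tensor_op_pullback(2)[OF A inj_on_translation])

lemma coord_absorbed_op:
  "coord (absorbed_op F) (a, s, t) =
    (\<Sum>g\<in>I. if s \<in> compressed_dom S\<^sub>1 S\<^sub>2 g \<and> t \<in> compressed_dom S\<^sub>1 S\<^sub>2 g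
      then coord (A g (slice (- g + s, - g + t) F)) a else 0)"
  by (simp add: absorbed_op_def coord_sum absorbed_op_summand
      tensor_op_pullback(2)[OF A inj_on_translation_pair] cong: if_cong)

lemma bounded_linear_plain_op: "bounded_linear plain_op"
  and bounded_linear_absorbed_op: "bounded_linear absorbed_op"
  unfolding plain_op_def[abs_def] absorbed_op_def[abs_def] absorbed_op_summand
  by (intro bounded_linear_sum bounded_clinearD(1) tensor_op_pullback(1) A
      inj_on_translation inj_on_translation_pair)+

text \<open>The component of a family on the orbit \<open>{(s, s + k) | s}\<close>. Left translation of both coordinates
  preserves \<open>k = - s + t\<close>; in a noncommutative group the increment must be added on the right.\<close>

definition diagonal :: "'g \<Rightarrow> ('x \<times> 'g \<times> 'g) ell2 \<Rightarrow> ('x \<times> 'g) ell2"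
  where "diagonal k = pullback UNIV (\<lambda>(a, s). (a, s, s + k))"

lemma inj_diagonal: "inj (\<lambda>(a, s). (a :: 'x, s, s + k))" for k :: 'g
  by (auto simp: inj_on_def)

lemma coord_diagonal: "coord (diagonal k F) (a, s) = coord F (a, s, s + k)"
  unfolding diagonal_def by (simp add: coord_pullback[OF inj_diagonal])

lemma norm_diagonals_has_sum: "((\<lambda>k. (norm (diagonal k F))\<^sup>2) has_sum (norm F)\<^sup>2) UNIV"
proof -
  have "bij (\<lambda>(k, a :: 'x, s :: 'g). (a, s, s + k))"
    by (rule bij_betwI[where g = "\<lambda>(a, s, t). (- s + t, a, s)"])
       (auto simp: add.assoc[symmetric])
  from norm_fibres_has_sum[OF this, of F] show ?thesis
    by (simp add: diagonal_def case_prod_unfold)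
qed

text \<open>On an orbit the second coordinate is determined by the first, so the second tensor factor only
  decides whether a summand is present: the source must satisfy \<open>s + k \<in> S\<^sub>2\<close> and the target
  \<open>s + k \<in> S\<^sub>1\<close>. Neither condition involves \<open>g\<close> any more, and both can be taken out of the sum as
  projections.\<close>

lemma diagonal_absorbed_op:
  "diagonal k (absorbed_op F) =
    proj_ell2 (UNIV \<times> {s. s + k \<in> S\<^sub>1}) (plain_op (proj_ell2 (UNIV \<times> {s. s + k \<in> S\<^sub>2}) (diagonal k F)))"
proof (rule ell2_eqI)
  fix p :: "'x \<times> 'g"
  obtain a s where p: "p = (a, s)" by (cases p)
  have slice: "slice r (proj_ell2 (UNIV \<times> {s. s + k \<in> S\<^sub>2}) (diagonal k F))
      = (if r + k \<in> S\<^sub>2 then slice (r, r + k) F else 0)" for r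
    by (rule ell2_eqI)
       (auto simp: coord_slice proj_ell2.rep_eq coord_diagonal zero_ell2.rep_eq)
  show "coord (diagonal k (absorbed_op F)) p = coord (proj_ell2 (UNIV \<times> {s. s + k \<in> S\<^sub>1})
      (plain_op (proj_ell2 (UNIV \<times> {s. s + k \<in> S\<^sub>2}) (diagonal k F)))) p"
  proof (cases "s + k \<in> S\<^sub>1")
    case True
    let ?f = "proj_ell2 (UNIV \<times> {s. s + k \<in> S\<^sub>2}) (diagonal k F)"
    have summand: "(if s \<in> compressed_dom S\<^sub>1 S\<^sub>2 g \<and> s + k \<in> compressed_dom S\<^sub>1 S\<^sub>2 g
          then coord (A g (slice (- g + s, - g + (s + k)) F)) a else 0)
        = (if s \<in> compressed_dom S\<^sub>1 S\<^sub>2 g then coord (A g (slice (- g + s) ?f)) a else 0)" for g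
      using True unfolding slice
      by (simp add: compressed_dom_def add.assoc bounded_clinearD(4)[OF A] zero_ell2.rep_eq)
    have "coord (diagonal k (absorbed_op F)) p = coord (plain_op ?f) p"
      by (simp only: p coord_diagonal coord_absorbed_op coord_plain_op summand)
    with True show ?thesis by (simp add: p proj_ell2.rep_eq)
  next
    case False
    then show ?thesis
      by (simp add: p coord_diagonal coord_absorbed_op proj_ell2.rep_eq compressed_dom_def)
  qed
qed

text \<open>The orbits are orthogonal, and on each of them the operator is a compression of
  \<^term>\<open>plain_op\<close>.\<close>

lemma onorm_absorbed_op_le: "onorm absorbed_op \<le> onorm plain_op"
proof (rule onorm_bound)
  show pos: "0 \<le> onorm plain_op" by (rule onorm_pos_le[OF bounded_linear_plain_op])
  fix F
  have "((\<lambda>k. (norm (diagonal k (absorbed_op F)))\<^sup>2) has_sum (norm (absorbed_op F))\<^sup>2) UNIV"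
    by (rule norm_diagonals_has_sum)
  moreover have "((\<lambda>k. (onorm plain_op)\<^sup>2 * (norm (diagonal k F))\<^sup>2)
      has_sum (onorm plain_op)\<^sup>2 * (norm F)\<^sup>2) UNIV"
    by (intro has_sum_cmult_right norm_diagonals_has_sum)
  moreover have "(norm (diagonal k (absorbed_op F)))\<^sup>2 \<le> (onorm plain_op)\<^sup>2 * (norm (diagonal k F))\<^sup>2" for k
  proof -
    let ?f = "proj_ell2 (UNIV \<times> {s. s + k \<in> S\<^sub>2}) (diagonal k F)"
    have "norm (diagonal k (absorbed_op F)) \<le> norm (plain_op ?f)"
      unfolding diagonal_absorbed_op by (rule norm_proj_ell2_le)
    also have "\<dots> \<le> onorm plain_op * norm ?f"
      by (rule onorm[OF bounded_linear_plain_op])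
    also have "\<dots> \<le> onorm plain_op * norm (diagonal k F)"
      by (intro mult_left_mono norm_proj_ell2_le pos)
    finally have "(norm (diagonal k (absorbed_op F)))\<^sup>2 \<le> (onorm plain_op * norm (diagonal k F))\<^sup>2"
      by (rule power_mono) simp
    then show ?thesis by (simp add: power_mult_distrib)
  qed
  ultimately have "(norm (absorbed_op F))\<^sup>2 \<le> (onorm plain_op)\<^sup>2 * (norm F)\<^sup>2"
    by (rule has_sum_mono)
  then show "norm (absorbed_op F) \<le> onorm plain_op * norm F"
    using pos by - (rule power2_le_imp_le, simp_all add: power_mult_distrib)
qed

text \<open>Restricted to the orbit \<open>k = 0\<close>, the operator \<^term>\<open>absorbed_op\<close> is
  \<^term>\<open>plain_op\<close>.\<close>

lemma onorm_plain_op_le: "onorm plain_op \<le> onorm absorbed_op"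
proof (rule onorm_bound)
  show pos: "0 \<le> onorm absorbed_op" by (rule onorm_pos_le[OF bounded_linear_absorbed_op])
  fix f
  \<comment> \<open>\<open>J\<close> embeds the summand on the orbit \<open>k = 0\<close>, extending by zero.\<close>
  define J :: "('x \<times> 'g) ell2 \<Rightarrow> ('x \<times> 'g \<times> 'g) ell2"
    where "J = pullback {(a, s, t). s = t} (\<lambda>(a, s, t). (a, s))"
  have inj: "inj_on (\<lambda>(a, s, t). (a, s)) {(a :: 'x, s :: 'g, t). s = t}"
    by (auto simp: inj_on_def)
  have slice: "slice (s, s) (J f) = slice s f" for s
    by (rule ell2_eqI) (simp add: coord_slice J_def coord_pullback[OF inj])
  have "plain_op f = diagonal 0 (absorbed_op (J f))"
  proof (rule ell2_eqI)
    fix p :: "'x \<times> 'g"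
    show "coord (plain_op f) p = coord (diagonal 0 (absorbed_op (J f))) p"
      by (cases p) (simp only: coord_diagonal coord_absorbed_op coord_plain_op add_0_right slice conj_absorb)
  qed
  then have "norm (plain_op f) \<le> norm (absorbed_op (J f))"
    by (simp only: diagonal_def norm_pullback_le[OF inj_diagonal])
  also have "\<dots> \<le> onorm absorbed_op * norm (J f)"
    by (rule onorm[OF bounded_linear_absorbed_op])
  also have "\<dots> \<le> onorm absorbed_op * norm f"
    unfolding J_def by (intro mult_left_mono norm_pullback_le inj pos)
  finally show "norm (plain_op f) \<le> onorm absorbed_op * norm f" .
qed

lemma onorm_self_absorption:
  "onorm (\<lambda>F. \<Sum>g\<in>I. (A g \<otimes>\<^sub>o translation g) F)
    = onorm (\<lambda>F. \<Sum>g\<in>I. (A g \<otimes>\<^sub>o (translation g \<otimes>\<^sub>o conj_op (translation g))) F)"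
  using onorm_plain_op_le onorm_absorbed_op_le
  unfolding plain_op_def[abs_def] absorbed_op_def[abs_def] by (rule antisym)

end

theorem corollary5p2:
  shows "hereditary_SAP TYPE('b::cstar_algebra)
    (left_regular :: 'g::{group_add, countable} \<Rightarrow> 'g ell2 \<Rightarrow> 'g ell2)"
proof -
  have "SAP TYPE('b) (\<lambda>g. pullback (compressed_dom S\<^sub>1 S\<^sub>2 g) ((+) (- g)))" for S\<^sub>1 S\<^sub>2 :: "'g set"
    unfolding SAP_def
  proof (intro conjI allI impI)
    show "bounded_clinear (pullback (compressed_dom S\<^sub>1 S\<^sub>2 g) ((+) (- g)))" for g
      by (rule bounded_clinear_pullback[OF inj_on_translation])
    fix b :: "'g \<Rightarrow> 'b"
    have bdd: "bounded_clinear (\<pi> (b g))" if "star_representation \<pi>"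
      for \<pi> :: "'b \<Rightarrow> 'b ell2 \<Rightarrow> 'b ell2" and g
      using that by (simp add: star_representation_def)
    show "min_tensor_norm b (\<lambda>g. pullback (compressed_dom S\<^sub>1 S\<^sub>2 g) ((+) (- g))) =
        min_tensor_norm b (\<lambda>g. pullback (compressed_dom S\<^sub>1 S\<^sub>2 g) ((+) (- g)) \<otimes>\<^sub>o
          conj_op (pullback (compressed_dom S\<^sub>1 S\<^sub>2 g) ((+) (- g))))"
      unfolding min_tensor_norm_def
    proof (rule SUP_cong[OF refl])
      fix \<pi> :: "'b \<Rightarrow> 'b ell2 \<Rightarrow> 'b ell2" assume "\<pi> \<in> {\<pi>. star_representation \<pi>}"
      then have A: "bounded_clinear (\<pi> (b g))" for g by (simp add: bdd)
      show "onorm (\<lambda>f. \<Sum>g | b g \<noteq> 0. (\<pi> (b g) \<otimes>\<^sub>o pullback (compressed_dom S\<^sub>1 S\<^sub>2 g) ((+) (- g))) f) =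
          onorm (\<lambda>f. \<Sum>g | b g \<noteq> 0. (\<pi> (b g) \<otimes>\<^sub>o pullback (compressed_dom S\<^sub>1 S\<^sub>2 g) ((+) (- g)) \<otimes>\<^sub>o
            conj_op (pullback (compressed_dom S\<^sub>1 S\<^sub>2 g) ((+) (- g)))) f)"
        by (rule onorm_self_absorption[where A = "\<lambda>g. \<pi> (b g)", OF A])
    qed
  qed
  then show ?thesis
    unfolding hereditary_SAP_def compressed_left_regular by (intro allI)
qed

end
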